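(* Let $G = KG(m,w)$ be a Kneser graph and let $G'$ be an induced subgraph of $G$. Then for every $n>0$, for all but at most $\frac{2^w(2w+2)}{n}|V(G')|^2$ edges $e$ of $G'$, there is a complete bipartite subgraph of $G'$ with at least $|V(G')|/n$ vertices on each side that contains $e$.
   Context: The Kneser graph $KG(m,w)$ has as vertices the $w$-element subsets of $\{1,\dots,m\}$, two vertices being adjacent iff the corresponding sets are disjoint. *)

theory Defs
  imports Complex_Main
begin

record 'a sgraph =
  verts :: "'a set"
  edges :: "'a set set"

text \<open>An edge is the two-element set of its endpoints. The condition \<open>A \<noteq> B\<close> only matters for
  \<open>w = 0\<close>, where the empty set is disjoint from itself and would carry a loop.\<close>

definition kneser_graph :: "nat \<Rightarrow> nat \<Rightarrow> nat set sgraph" where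
  "kneser_graph m w =
    \<lparr> verts = {A. A \<subseteq> {1..m} \<and> card A = w},
      edges = {{A, B} | A B. A \<subseteq> {1..m} \<and> card A = w \<and> B \<subseteq> {1..m} \<and> card B = w \<and>
                             A \<noteq> B \<and> A \<inter> B = {}} \<rparr>"

definition subgraph :: "'a sgraph \<Rightarrow> 'a sgraph \<Rightarrow> bool" where
  "subgraph H G \<longleftrightarrow> verts H \<subseteq> verts G \<and> edges H \<subseteq> edges G"

definition induced_subgraph :: "'a sgraph \<Rightarrow> 'a sgraph \<Rightarrow> bool" where
  "induced_subgraph H G \<longleftrightarrow> verts H \<subseteq> verts G \<and> edges H = {e \<in> edges G. e \<subseteq> verts H}"

definition complete_bipartite :: "'a sgraph \<Rightarrow> 'a set \<Rightarrow> 'a set \<Rightarrow> bool" where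
  "complete_bipartite H X Y \<longleftrightarrow>
    X \<inter> Y = {} \<and> verts H = X \<union> Y \<and> edges H = {{x, y} | x y. x \<in> X \<and> y \<in> Y}"

end

theory Submission
  imports Defs
begin

text \<open>Write \<open>V = {1..m}\<close>, \<open>F = verts G'\<close> and \<open>t = |F| / n\<close>. A subset \<open>U\<close> of \<open>V\<close> yields the complete
  bipartite graph between the members of \<open>F\<close> inside \<open>U\<close> and those disjoint from \<open>U\<close>; if it separates
  a bad edge, then one of the two sides has fewer than \<open>t\<close> members, so it separates at most \<open>t\<close> times
  (size of one side + size of the other side) bad edges. Average over all \<open>U\<close>: a given edge is
  separated with probability \<open>4\<^sup>-\<^sup>w\<close>, while each side has expected size \<open>2\<^sup>-\<^sup>w |F|\<close>. Hence there are at
  most \<open>2\<^sup>w\<^sup>+\<^sup>1 t |F|\<close> bad edges.\<close>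

text \<open>The sets \<open>U\<close> in question are exactly the unions \<open>A \<union> W\<close>
  with \<open>W\<close> an arbitrary subset of \<open>V - (A \<union> B)\<close>. The product form
  avoids truncated subtraction in the exponent.\<close>

lemma card_separating_sets:
  assumes "finite V" "A \<subseteq> V" "B \<subseteq> V" "A \<inter> B = {}"
  shows "card {U \<in> Pow V. A \<subseteq> U \<and> B \<inter> U = {}} * 2 ^ (card A + card B) = 2 ^ card V"
proof -
  have "bij_betw (\<lambda>W. A \<union> W) (Pow (V - (A \<union> B))) {U \<in> Pow V. A \<subseteq> U \<and> B \<inter> U = {}}"
    by (rule bij_betw_byWitness[where f' = "\<lambda>U. U - A"]) (use assms in auto)
  then have "card {U \<in> Pow V. A \<subseteq> U \<and> B \<inter> U = {}} = card (Pow (V - (A \<union> B)))"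
    by (rule bij_betw_same_card[symmetric])
  moreover have "card (V - (A \<union> B)) + (card A + card B) = card V"
  proof -
    have fin: "finite A" "finite B"
      using assms by (auto intro: finite_subset)
    then have "card (A \<union> B) = card A + card B"
      using assms(4) by (rule card_Un_disjoint)
    moreover have "card (V - (A \<union> B)) + card (A \<union> B) = card V"
      using assms(1-3) fin card_Diff_subset[of "A \<union> B" V] card_mono[of V "A \<union> B"] by simp
    ultimately show ?thesis by simp
  qed
  ultimately show ?thesis
    using assms(1) by (simp add: card_Pow flip: power_add)
qed

text \<open>Double counting of pairs \<open>(U, A)\<close>: a fixed \<open>A\<close> in
  \<open>F\<close> lies inside a \<open>2^-w\<close> share of all \<open>U\<close>, and is disjoint
  from the same share. These are the expected side sizes, cleared of denominators.\<close>

lemma sum_Pow_card_inside_outside: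
  assumes "finite V" "finite F" "\<And>A. A \<in> F \<Longrightarrow> A \<subseteq> V \<and> card A = w"
  shows "(\<Sum>U\<in>Pow V. real (card {A \<in> F. A \<subseteq> U})) * 2 ^ w = 2 ^ card V * real (card F)"
    and "(\<Sum>U\<in>Pow V. real (card {A \<in> F. A \<inter> U = {}})) * 2 ^ w = 2 ^ card V * real (card F)"
proof -
  have *: "(\<Sum>U\<in>Pow V. card {A \<in> F. R A U}) * 2 ^ w = 2 ^ card V * card F"
    if "\<And>A. A \<in> F \<Longrightarrow> card {U \<in> Pow V. R A U} * 2 ^ w = 2 ^ card V" for R :: "'a set \<Rightarrow> 'a set \<Rightarrow> bool"
  proof -
    have "\<forall>A\<in>F. card {U \<in> Pow V. R A U} = 2 ^ card V div 2 ^ w"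
      using that by (metis nonzero_mult_div_cancel_right power_not_zero zero_neq_numeral)
    then have "(\<Sum>U\<in>Pow V. card {A \<in> F. R A U}) = 2 ^ card V div 2 ^ w * card F"
      using sum_multicount[of "Pow V" F "\<lambda>U A. R A U"] assms by simp
    \<comment> \<open>The division above is exact as soon as \<open>F\<close> has a member to
      witness divisibility; for empty \<open>F\<close> both sides vanish.\<close>
    moreover have "F \<noteq> {} \<Longrightarrow> 2 ^ w dvd (2 ^ card V :: nat)"
      using that by (metis all_not_in_conv dvd_triv_right)
    ultimately show ?thesis by (cases "F = {}") auto
  qed
  show "(\<Sum>U\<in>Pow V. real (card {A \<in> F. A \<subseteq> U})) * 2 ^ w = 2 ^ card V * real (card F)"
  proof -
    have "card {U \<in> Pow V. A \<subseteq> U} * 2 ^ w = 2 ^ card V" if "A \<in> F" for A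
      using card_separating_sets[of V A "{}"] assms(1) assms(3)[OF that] by auto
    then have "(\<Sum>U\<in>Pow V. card {A \<in> F. A \<subseteq> U}) * 2 ^ w = 2 ^ card V * card F"
      by (rule *)
    from arg_cong[OF this, of real] show ?thesis by simp
  qed
  show "(\<Sum>U\<in>Pow V. real (card {A \<in> F. A \<inter> U = {}})) * 2 ^ w = 2 ^ card V * real (card F)"
  proof -
    have "card {U \<in> Pow V. A \<inter> U = {}} * 2 ^ w = 2 ^ card V" if "A \<in> F" for A
      using card_separating_sets[of V "{}" A] assms(1) assms(3)[OF that] by auto
    then have "(\<Sum>U\<in>Pow V. card {A \<in> F. A \<inter> U = {}}) * 2 ^ w = 2 ^ card V * card F"
      by (rule *)
    from arg_cong[OF this, of real] show ?thesis by simp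
  qed
qed

text \<open>The factor below \<open>t\<close> is replaced by \<open>t\<close>. Adding the other term
  makes the bound symmetric, so it holds whichever side is small, and linear in \<open>x\<close> and
  \<open>y\<close>, so it can be summed over all \<open>U\<close>.\<close>

lemma mult_le_mult_add_if_less:
  fixes x y t :: real
  assumes "0 \<le> x" "0 \<le> y" "0 \<le> t" "x < t \<or> y < t"
  shows "x * y \<le> t * (x + y)"
proof -
  have "x * y \<le> t * y \<or> x * y \<le> t * x"
    using assms mult_right_mono[of x t y] mult_left_mono[of y t x] by (auto simp: mult.commute)
  moreover have "0 \<le> t * x" "0 \<le> t * y"
    using assms by auto
  ultimately show ?thesis by (auto simp: distrib_left)
qed

lemma card_disjoint_pairs_le:
  fixes t :: real
  assumes V: "finite V" and F: "finite F" "\<And>A. A \<in> F \<Longrightarrow> A \<subseteq> V \<and> card A = w"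
    and P: "P \<subseteq> F \<times> F" "\<And>A B. (A, B) \<in> P \<Longrightarrow> A \<inter> B = {}"
    and t: "0 \<le> t"
    and small: "\<And>A B U. (A, B) \<in> P \<Longrightarrow> A \<subseteq> U \<Longrightarrow> B \<inter> U = {} \<Longrightarrow>
      real (card {C \<in> F. C \<subseteq> U}) < t \<or> real (card {C \<in> F. C \<inter> U = {}}) < t"
  shows "real (card P) \<le> 2 ^ w * (2 * t * card F)"
proof -
  define S where "S U = {p \<in> P. fst p \<subseteq> U \<and> snd p \<inter> U = {}}" for U
  define X where "X U = {C \<in> F. C \<subseteq> U}" for U
  define Y where "Y U = {C \<in> F. C \<inter> U = {}}" for U
  have finP: "finite P"
    using P F by (meson finite_SigmaI finite_subset)
  \<comment> \<open>A single separated pair already triggers \<open>small\<close>, which then bounds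
    the whole product \<open>X U \<times> Y U\<close> containing \<open>S U\<close>.\<close>
  have S_le: "real (card (S U)) \<le> t * (real (card (X U)) + real (card (Y U)))" for U
  proof (cases "S U = {}")
    case True
    then show ?thesis using t by simp
  next
    case False
    then obtain A B where "(A, B) \<in> P" "A \<subseteq> U" "B \<inter> U = {}"
      unfolding S_def by auto
    then have "real (card (X U)) < t \<or> real (card (Y U)) < t"
      unfolding X_def Y_def by (rule small)
    then have "real (card (X U)) * card (Y U) \<le> t * (real (card (X U)) + real (card (Y U)))"
      using mult_le_mult_add_if_less[of "card (X U)" "card (Y U)" t] t by simp
    moreover have "S U \<subseteq> X U \<times> Y U"
      using P(1) unfolding S_def X_def Y_def by auto
    then have "card (S U) \<le> card (X U) * card (Y U)"
      using card_mono[of "X U \<times> Y U" "S U"] F(1) by (simp add: X_def Y_def card_cartesian_product)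
    then have "real (card (S U)) \<le> real (card (X U)) * card (Y U)"
      unfolding of_nat_mult[symmetric] of_nat_le_iff .
    ultimately show ?thesis by linarith
  qed
  have sep: "card {U \<in> Pow V. fst p \<subseteq> U \<and> snd p \<inter> U = {}} * 2 ^ (w + w) = 2 ^ card V" if "p \<in> P" for p
  proof -
    obtain A B where p: "p = (A, B)" by force
    then have "A \<in> F" "B \<in> F" "A \<inter> B = {}" using that P by auto
    then show ?thesis using card_separating_sets[of V A B] V F(2) p by auto
  qed
  \<comment> \<open>Pairs \<open>(p, U)\<close> with \<open>U\<close> separating \<open>p\<close>
    are counted in two ways; the exponent \<open>w + w\<close> comes from the two disjoint
    \<open>w\<close>-sets of \<open>p\<close>.\<close>
  have "card P * 2 ^ card V = (\<Sum>p\<in>P. card {U \<in> Pow V. fst p \<subseteq> U \<and> snd p \<inter> U = {}} * 2 ^ (w + w))"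
    using sep by simp
  also have "\<dots> = (\<Sum>U\<in>Pow V. card (S U)) * 2 ^ (w + w)"
    using sum_multicount_gen[of "Pow V" P "\<lambda>U p. fst p \<subseteq> U \<and> snd p \<inter> U = {}"
        "\<lambda>p. card {U \<in> Pow V. fst p \<subseteq> U \<and> snd p \<inter> U = {}}"] V finP
    by (simp add: S_def sum_distrib_right)
  finally have "real (card P * 2 ^ card V) = real ((\<Sum>U\<in>Pow V. card (S U)) * 2 ^ (w + w))"
    by (rule arg_cong)
  then have "real (card P) * 2 ^ card V = (\<Sum>U\<in>Pow V. real (card (S U))) * 2 ^ (w + w)"
    by simp
  also have "\<dots> \<le> (\<Sum>U\<in>Pow V. t * (real (card (X U)) + real (card (Y U)))) * 2 ^ (w + w)"
    by (intro mult_right_mono sum_mono S_le) simp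
  \<comment> \<open>One factor \<open>2 ^ w\<close> goes into the sums, where it cancels the density
    of each side; the other survives in the final bound.\<close>
  also have "\<dots> = t * 2 ^ w * ((\<Sum>U\<in>Pow V. real (card (X U))) * 2 ^ w
      + (\<Sum>U\<in>Pow V. real (card (Y U))) * 2 ^ w)"
    by (simp add: sum.distrib sum_distrib_left[symmetric] power_add algebra_simps)
  also have "\<dots> = t * 2 ^ w * (2 ^ card V * real (card F) + 2 ^ card V * real (card F))"
    using sum_Pow_card_inside_outside[OF V F] unfolding X_def Y_def by simp
  also have "\<dots> = (2 ^ w * (2 * t * card F)) * 2 ^ card V"
    by (simp add: algebra_simps)
  finally show ?thesis
    by simp
qed

theorem theorem1p5:
  fixes m w :: nat and n :: real and G' :: "nat set sgraph"
  assumes "induced_subgraph G' (kneser_graph m w)"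
    and "n > 0"
  shows "real (card {e \<in> edges G'.
            \<not> (\<exists>H X Y. subgraph H G' \<and> complete_bipartite H X Y \<and>
                  real (card X) \<ge> real (card (verts G')) / n \<and>
                  real (card Y) \<ge> real (card (verts G')) / n \<and>
                  e \<in> edges H)})
         \<le> 2 ^ w * (2 * real w + 2) / n * (real (card (verts G')))\<^sup>2"
proof -
  define F where "F = verts G'"
  define t where "t = real (card F) / n"
  define good where "good e \<longleftrightarrow> (\<exists>H X Y. subgraph H G' \<and> complete_bipartite H X Y \<and>
    t \<le> real (card X) \<and> t \<le> real (card Y) \<and> e \<in> edges H)" for e
  define E where "E = {e \<in> edges G'. \<not> good e}"
  \<comment> \<open>Bad edges with both orientations, since separation by \<open>U\<close>
    distinguishes the inner endpoint from the outer one.\<close>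
  define P where "P = {(A, B) \<in> F \<times> F. {A, B} \<in> E}"
  have F: "A \<subseteq> {1..m} \<and> card A = w" if "A \<in> F" for A
    using that assms(1) unfolding F_def induced_subgraph_def kneser_graph_def by auto
  have "F \<subseteq> Pow {1..m}"
    using F by blast
  then have finF: "finite F"
    by (rule finite_subset) simp
  have edges: "e \<in> edges G' \<longleftrightarrow> (\<exists>A B. e = {A, B} \<and> A \<in> F \<and> B \<in> F \<and> A \<noteq> B \<and> A \<inter> B = {})" for e
  proof
    assume "e \<in> edges G'"
    then have "e \<in> edges (kneser_graph m w)" and sub: "e \<subseteq> F"
      using assms(1) by (simp_all add: induced_subgraph_def F_def)
    then obtain A B where "e = {A, B}" "A \<noteq> B" "A \<inter> B = {}"
      unfolding kneser_graph_def sgraph.simps mem_Collect_eq by (elim exE conjE)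
    with sub show "\<exists>A B. e = {A, B} \<and> A \<in> F \<and> B \<in> F \<and> A \<noteq> B \<and> A \<inter> B = {}"
      by (metis insert_subset)
  next
    assume "\<exists>A B. e = {A, B} \<and> A \<in> F \<and> B \<in> F \<and> A \<noteq> B \<and> A \<inter> B = {}"
    then obtain A B where e: "e = {A, B}" "A \<in> F" "B \<in> F" "A \<noteq> B" "A \<inter> B = {}"
      by (elim exE conjE)
    then have "e \<in> edges (kneser_graph m w)"
      unfolding kneser_graph_def sgraph.simps mem_Collect_eq
      using F[of A] F[of B] by (intro exI[of _ A] exI[of _ B] conjI) simp_all
    then show "e \<in> edges G'"
      using assms(1) e by (simp add: induced_subgraph_def F_def)
  qed
  have t: "0 \<le> t"
    using assms(2) by (simp add: t_def)
  have P_disj: "A \<noteq> B \<and> A \<inter> B = {}" if "(A, B) \<in> P" for A B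
  proof -
    have "{A, B} \<in> edges G'" using that by (simp add: P_def E_def)
    then obtain C D where "{A, B} = {C, D}" "C \<noteq> D" "C \<inter> D = {}"
      unfolding edges by (elim exE conjE)
    then show ?thesis
      unfolding doubleton_eq_iff by (elim disjE conjE) (simp_all add: Int_commute)
  qed
  have "real (card P) \<le> 2 ^ w * (2 * t * card F)"
  proof (rule card_disjoint_pairs_le[OF _ finF F _ _ t])
    fix A B U assume AB: "(A, B) \<in> P" "A \<subseteq> U" "B \<inter> U = {}"
    define X where "X = {C \<in> F. C \<subseteq> U}"
    define Y where "Y = {C \<in> F. C \<inter> U = {}}"
    define H where "H = \<lparr>verts = X \<union> Y, edges = {{x, y} | x y. x \<in> X \<and> y \<in> Y}\<rparr>"
    have mem: "A \<in> X" "B \<in> Y" "\<not> good {A, B}"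
      using AB by (auto simp: X_def Y_def P_def E_def)
    \<comment> \<open>The empty set is the only set that could lie in both \<open>X\<close> and
      \<open>Y\<close>. Its presence would force \<open>w = 0\<close>, hence
      \<open>A = B = {}\<close>, but the endpoints of an edge are distinct.\<close>
    have "{} \<notin> F"
    proof
      assume "{} \<in> F"
      then have "w = 0" using F by fastforce
      then have "A = {}" "B = {}"
        using F[of A] F[of B] mem finite_subset[of _ "{1..m}"] by (auto simp: X_def Y_def)
      then show False using P_disj AB by blast
    qed
    then have XY: "X \<inter> Y = {}"
      unfolding X_def Y_def by (auto simp: Int_absorb2)
    have "subgraph H G'"
      unfolding subgraph_def
    proof
      show "verts H \<subseteq> verts G'"
        by (auto simp: H_def X_def Y_def F_def)
      show "edges H \<subseteq> edges G'"
      proof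
        fix e assume "e \<in> edges H"
        then obtain x y where e: "e = {x, y}" "x \<in> X" "y \<in> Y" by (auto simp: H_def)
        \<comment> \<open>Since \<open>x\<close> lies inside \<open>U\<close> and \<open>y\<close>
          misses \<open>U\<close>, the two are disjoint, so \<open>G'\<close>, being induced, has
          the edge between them.\<close>
        then have "x \<in> F" "y \<in> F" "x \<noteq> y" "x \<inter> y = {}"
          using XY by (auto simp: X_def Y_def)
        then show "e \<in> edges G'" unfolding edges using e(1) by blast
      qed
    qed
    moreover have "complete_bipartite H X Y" "{A, B} \<in> edges H"
      using XY mem by (auto simp: complete_bipartite_def H_def)
    ultimately have "\<not> (t \<le> real (card X) \<and> t \<le> real (card Y))"
      using mem(3) unfolding good_def by blast
    then show "real (card {C \<in> F. C \<subseteq> U}) < t \<or> real (card {C \<in> F. C \<inter> U = {}}) < t"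
      unfolding X_def Y_def by linarith
  qed (use P_disj in \<open>auto simp: P_def\<close>)
  \<comment> \<open>Forgetting the orientation maps \<open>P\<close> onto a superset of
    \<open>E\<close>, so the bound on \<open>P\<close> passes to \<open>E\<close>.\<close>
  moreover have "E \<subseteq> (\<lambda>(A, B). {A, B}) ` P"
  proof
    fix e assume "e \<in> E"
    moreover from this obtain A B where "e = {A, B}" "A \<in> F" "B \<in> F"
      unfolding E_def mem_Collect_eq edges by (elim exE conjE)
    ultimately show "e \<in> (\<lambda>(A, B). {A, B}) ` P"
      by (auto simp: P_def intro!: image_eqI[where x = "(A, B)"])
  qed
  then have "card E \<le> card P"
    using finF by (intro surj_card_le) (auto simp: P_def intro: finite_subset[of _ "F \<times> F"])
  ultimately have "real (card E) \<le> 2 ^ w * (2 * t * card F)"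
    by linarith
  \<comment> \<open>Averaging gives the constant \<open>2\<close>, which is at most
    \<open>2 * real w + 2\<close>.\<close>
  also have "\<dots> \<le> 2 ^ w * ((2 * real w + 2) * t * card F)"
    using t by (intro mult_left_mono mult_right_mono) auto
  also have "\<dots> = 2 ^ w * (2 * real w + 2) / n * (real (card F))\<^sup>2"
    by (simp add: t_def power2_eq_square)
  finally show ?thesis
    unfolding E_def good_def t_def F_def .
qed

end
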